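(* Let $k\ge 1$ be an integer. (Continuous part.) Let $g[u]$ and $f[u]$ be smooth functions of $u=u(x,t)$ and finitely many of its partial derivatives. Then the partial differential equation $$D_t\left(g[u]\right)+D_x^{\,k}\left(f[u]\right)=0$$ has $k$ conservation laws whose characteristics are $Q_i=x^{i-1}$, $i=1,\dots,k$. That is, for each $i\in\{1,\dots,k\}$ there exist functions $F_i,G_i$ of $x$, $t$, $u$ and finitely many derivatives of $u$ such that, identically in $u$, $$x^{i-1}\left(D_t(g[u])+D_x^{\,k}(f[u])\right)=D_x(F_i)+D_t(G_i).$$ (Discrete part.) Let $\widetilde{g[u]}$ and $\widetilde{f[u]}$ be finite difference approximations to $g[u]$ and $f[u]$ respectively, i.e. functions of finitely many shifts of the grid function $u_{0,0}$. Then the scheme $$D_n\left(\widetilde{g[u]}\right)+D_m^{\,k}\left(\widetilde{f[u]}\right)=0$$ has $k$ discrete conservation laws whose characteristics are $\widetilde{Q_i}=x_0^{\,i-1}$, $i=1,\dots,k$. That is, for each $i\in\{1,\dots,k\}$ there exist functions $\widetilde{F_i},\widetilde{G_i}$ of the lattice point and finitely many shifts of $u_{0,0}$ such that, identically in the grid function $u$, $$x_0^{\,i-1}\left(D_n\left(\widetilde{g[u]}\right)+D_m^{\,k}\left(\widetilde{f[u]}\right)\right)=D_m\left(\widetilde{F_i}\right)+D_n\left(\widetilde{G_i}\right).$$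
   Context: $D_x$ and $D_t$ are the total derivatives with respect to $x$ and $t$. A conservation law in characteristic form of a PDE $\mathcal{A}=0$ is an identity $D_x F+D_t G=\mathcal{Q}\mathcal{A}$, where $F,G$ are functions of $x,t,u$ and finitely many derivatives of $u$; $\mathcal{Q}$ is its characteristic. Discrete setting: a uniform grid with stepsizes $\Delta x,\Delta t>0$. Relative to a generic lattice point $(m,n)\in\mathbb{Z}^2$, the grid points are $x_i=x(m+i)=x(m)+i\Delta x$ and $t_j=t(n+j)=t(n)+j\Delta t$, and $u_{i,j}$ denotes the value of the grid function at $(x_i,t_j)$. The forward shifts act by $S_m:(x_i,t_j,u_{i,j})\mapsto(x_{i+1},t_j,u_{i+1,j})$ and $S_n:(x_i,t_j,u_{i,j})\mapsto(x_i,t_{j+1},u_{i,j+1})$; they are extended to functions of the lattice point and of finitely many $u_{i,j}$. The forward differences are $D_m=\frac{1}{\Delta x}(S_m-I)$ and $D_n=\frac{1}{\Delta t}(S_n-I)$, with $I$ the identity. A discrete conservation law in characteristic form of a scheme $\widetilde{\mathcal{A}}=0$ is an identity $D_m(\widetilde F)+D_n(\widetilde G)=\widetilde{\mathcal{Q}}\,\widetilde{\mathcal{A}}$, with $\widetilde F,\widetilde G$ functions of the lattice point and finitely many shifts of $u_{0,0}$; $\widetilde{\mathcal{Q}}$ is its characteristic. *)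

theory Defs
  imports "HOL-Analysis.Analysis" "HOL-Library.Groups_Big_Fun"
begin

definition depends_only_on :: "'c set \<Rightarrow> (('c \<Rightarrow> real) \<Rightarrow> real) \<Rightarrow> bool" where
  "depends_only_on S F \<longleftrightarrow> (\<forall>p q. (\<forall>c\<in>S. p c = q c) \<longrightarrow> F p = F q)"

text \<open>
  Coordinates of the infinite jet space of \<open>u(x,t)\<close>: \<open>Coord_u a b\<close> is the coordinate of
  the derivative of \<open>u\<close> taken \<open>a\<close> times in \<open>x\<close> and \<open>b\<close> times in \<open>t\<close>; in particular
  \<open>Coord_u 0 0\<close> is \<open>u\<close> itself. An identity ``in \<open>u\<close>'' is an identity at all jets.
\<close>

datatype jet_coord = Coord_x | Coord_t | Coord_u nat nat

type_synonym jet = "jet_coord \<Rightarrow> real"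

definition partial :: "jet_coord \<Rightarrow> (jet \<Rightarrow> real) \<Rightarrow> jet \<Rightarrow> real" where
  "partial c F p = deriv (\<lambda>s. F (p(c := s))) (p c)"

text \<open>
  Smoothness: all iterated partial derivatives exist and are continuous. Continuity is with
  respect to the product topology, which for functions of finitely many coordinates is
  continuity in these coordinates.
\<close>

definition smooth :: "(jet \<Rightarrow> real) \<Rightarrow> bool" where
  "smooth F \<longleftrightarrow>
     (\<forall>cs. continuous_on UNIV (fold partial cs F) \<and>
        (\<forall>c p. (\<lambda>s. fold partial cs F (p(c := s))) field_differentiable at (p c)))"

definition differential_function :: "(jet \<Rightarrow> real) \<Rightarrow> bool" where
  "differential_function F \<longleftrightarrow> smooth F \<and> (\<exists>S. finite S \<and> depends_only_on S F)"

text \<open>Differential functions of \<open>u\<close> and its derivatives, without explicit \<open>x\<close> and \<open>t\<close>.\<close>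

definition autonomous_differential_function :: "(jet \<Rightarrow> real) \<Rightarrow> bool" where
  "autonomous_differential_function F \<longleftrightarrow>
     smooth F \<and> (\<exists>S. finite S \<and> depends_only_on (case_prod Coord_u ` S) F)"

text \<open>
  For functions of finitely many coordinates only finitely many summands below are nonzero,
  so that \<open>Sum_any\<close> is the actual sum.
\<close>

definition Dx :: "(jet \<Rightarrow> real) \<Rightarrow> jet \<Rightarrow> real" where
  "Dx F p = partial Coord_x F p
     + Sum_any (\<lambda>(a, b). p (Coord_u (Suc a) b) * partial (Coord_u a b) F p)"

definition Dt :: "(jet \<Rightarrow> real) \<Rightarrow> jet \<Rightarrow> real" where
  "Dt F p = partial Coord_t F p
     + Sum_any (\<lambda>(a, b). p (Coord_u a (Suc b)) * partial (Coord_u a b) F p)"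

definition conservation_law ::
  "(jet \<Rightarrow> real) \<Rightarrow> (jet \<Rightarrow> real) \<Rightarrow> (jet \<Rightarrow> real) \<Rightarrow> (jet \<Rightarrow> real) \<Rightarrow> bool" where
  "conservation_law A Q F G \<longleftrightarrow>
     differential_function F \<and> differential_function G \<and>
     (\<forall>p. Dx F p + Dt G p = Q p * A p)"

definition uniform_grid :: "(int \<Rightarrow> real) \<Rightarrow> real \<Rightarrow> bool" where
  "uniform_grid x h \<longleftrightarrow> h > 0 \<and> (\<forall>m i. x (m + i) = x m + of_int i * h)"

text \<open>
  The grid function is given by its values relative to the lattice point \<open>(m,n)\<close>: in
  \<open>F m n u\<close>, \<open>u (i, j)\<close> is its value at the lattice point \<open>(m+i,n+j)\<close>.
\<close>

type_synonym lattice_function = "int \<Rightarrow> int \<Rightarrow> (int \<times> int \<Rightarrow> real) \<Rightarrow> real"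

text \<open>The finite stencil \<open>S\<close> does not depend on the lattice point.\<close>

definition difference_function :: "lattice_function \<Rightarrow> bool" where
  "difference_function F \<longleftrightarrow> (\<exists>S. finite S \<and> (\<forall>m n. depends_only_on S (F m n)))"

definition Sm :: "lattice_function \<Rightarrow> lattice_function" where
  "Sm F m n u = F (m + 1) n (\<lambda>(i, j). u (i + 1, j))"

definition Sn :: "lattice_function \<Rightarrow> lattice_function" where
  "Sn F m n u = F m (n + 1) (\<lambda>(i, j). u (i, j + 1))"

definition Dm :: "real \<Rightarrow> lattice_function \<Rightarrow> lattice_function" where
  "Dm \<Delta>x F m n u = (Sm F m n u - F m n u) / \<Delta>x"

definition Dn :: "real \<Rightarrow> lattice_function \<Rightarrow> lattice_function" where
  "Dn \<Delta>t F m n u = (Sn F m n u - F m n u) / \<Delta>t"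

definition discrete_conservation_law ::
  "real \<Rightarrow> real \<Rightarrow> lattice_function \<Rightarrow> lattice_function \<Rightarrow>
     lattice_function \<Rightarrow> lattice_function \<Rightarrow> bool" where
  "discrete_conservation_law \<Delta>x \<Delta>t A Q F G \<longleftrightarrow>
     difference_function F \<and> difference_function G \<and>
     (\<forall>m n u. Dm \<Delta>x F m n u + Dn \<Delta>t G m n u = Q m n u * A m n u)"

end

theory Submission
  imports Defs
begin

text \<open>
  Both parts are (summation) integration by parts. In the continuous case
  \<open>x\<^sup>j D\<^sub>x\<^sup>k f = D\<^sub>x(x\<^sup>j D\<^sub>x\<^sup>k\<^sup>-\<^sup>1 f) - j x\<^sup>j\<^sup>-\<^sup>1 D\<^sub>x\<^sup>k\<^sup>-\<^sup>1 f\<close>, so the power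
  of \<open>x\<close> and the order of the derivative decrease together and \<open>j < k\<close> makes the expression an
  \<open>x\<close>-derivative. In the discrete case \<open>x\<^sup>j D\<^sub>m h = D\<^sub>m((x - \<Delta>x)\<^sup>j h) - c h\<close>, where \<open>c\<close> is the
  backward difference of \<open>x\<^sup>j\<close>, a polynomial of degree less than \<open>j\<close> in \<open>x\<close>. The factor
  \<open>x\<^sup>j\<close> commutes with \<open>D\<^sub>t\<close> and \<open>D\<^sub>n\<close>.
\<close>

section \<open>Smooth functions on the jet space\<close>

lemma smoothD:
  assumes "smooth F"
  shows "continuous_on UNIV F"
    and "((\<lambda>s. F (p(c := s))) has_field_derivative partial c F p) (at (p c))"
    and "smooth (partial c F)"
proof -
  have *: "continuous_on UNIV (fold partial cs F)"
    "(\<lambda>s. fold partial cs F (p(c := s))) field_differentiable at (p c)" for cs c p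
    using assms unfolding smooth_def by blast+
  show "continuous_on UNIV F"
    using *(1)[of "[]"] by simp
  show "((\<lambda>s. F (p(c := s))) has_field_derivative partial c F p) (at (p c))"
    using *(2)[of "[]" p c] unfolding partial_def
    by (simp add: DERIV_deriv_iff_field_differentiable)
  show "smooth (partial c F)"
    unfolding smooth_def using *[of "c # cs" for cs] by simp
qed

text \<open>Smoothness speaks of all iterated partial derivatives. A property stable under
  \<open>partial\<close> reaches each of them by induction on the list, so no closed form for
  iterated derivatives of a product is needed.\<close>

lemma smooth_coinduct:
  assumes "P F"
    and cont: "\<And>F. P F \<Longrightarrow> continuous_on UNIV F"
    and diff: "\<And>F c p. P F \<Longrightarrow> (\<lambda>s. F (p(c := s))) field_differentiable at (p c)"
    and step: "\<And>F c. P F \<Longrightarrow> P (partial c F)"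
  shows "smooth F"
proof -
  have "P (fold partial cs F)" for cs
    using \<open>P F\<close> by (induction cs arbitrary: F) (auto intro: step)
  then show ?thesis
    unfolding smooth_def using cont diff by blast
qed

lemma partial_eqI:
  assumes "((\<lambda>s. F (p(c := s))) has_field_derivative D) (at (p c))"
  shows "partial c F p = D"
  using assms unfolding partial_def by (rule DERIV_imp_deriv)

lemma partial_const: "partial c (\<lambda>p. a) = (\<lambda>p. 0)"
  by (intro ext partial_eqI) simp

text \<open>For \<open>n = 0\<close> the truncated exponent \<open>n - 1\<close> is harmless, since
  the factor \<open>real n\<close> vanishes.\<close>

lemma partial_power_coord:
  "partial d (\<lambda>p. p c ^ n) = (\<lambda>p. if c = d then real n * p c ^ (n - 1) else 0)"
  by (intro ext partial_eqI) (auto intro!: derivative_eq_intros)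

lemma partial_coord: "partial d (\<lambda>p. p c) = (\<lambda>p. if c = d then 1 else 0)"
  using partial_power_coord[of d c 1] by simp

text \<open>
  The set of functions below is closed under partial derivatives by the product rule, so that
  coinduction applies to it.
\<close>

inductive smooth_algebra :: "(jet \<Rightarrow> real) \<Rightarrow> bool" where
  base: "smooth F \<Longrightarrow> smooth_algebra F"
| const: "smooth_algebra (\<lambda>p. a)"
| coord: "smooth_algebra (\<lambda>p. p c)"
| add: "smooth_algebra F \<Longrightarrow> smooth_algebra G \<Longrightarrow> smooth_algebra (\<lambda>p. F p + G p)"
| mult: "smooth_algebra F \<Longrightarrow> smooth_algebra G \<Longrightarrow> smooth_algebra (\<lambda>p. F p * G p)"

lemma smooth_algebra_continuous: "smooth_algebra F \<Longrightarrow> continuous_on UNIV F"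
  by (induction rule: smooth_algebra.induct)
    (auto intro: smoothD continuous_intros continuous_on_product_coordinates)

lemma smooth_algebra_differentiable:
  "smooth_algebra F \<Longrightarrow> (\<lambda>s. F (p(c := s))) field_differentiable at (p c)"
proof (induction rule: smooth_algebra.induct)
  case (base F)
  then show ?case
    using smoothD(2) field_differentiable_def by blast
next
  case (coord d)
  then show ?case
    by (cases "c = d") auto
qed (auto intro: derivative_intros)

text \<open>Only differentiability at the point is assumed: the rules serve to prove closure of
  \<open>smooth_algebra\<close> under \<open>partial\<close>, before smoothness of its members is
  known.\<close>

lemma partial_add_mult:
  assumes "(\<lambda>s. F (p(c := s))) field_differentiable at (p c)"
    and "(\<lambda>s. G (p(c := s))) field_differentiable at (p c)"
  shows "partial c (\<lambda>p. F p + G p) p = partial c F p + partial c G p"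
    and "partial c (\<lambda>p. F p * G p) p = F p * partial c G p + partial c F p * G p"
  using assms unfolding partial_def by simp_all

lemma smooth_algebra_partial: "smooth_algebra F \<Longrightarrow> smooth_algebra (partial c F)"
proof (induction rule: smooth_algebra.induct)
  case (base F)
  then show ?case
    by (intro smooth_algebra.base smoothD)
next
  case (const a)
  then show ?case
    by (simp add: partial_const smooth_algebra.const)
next
  case (coord d)
  then show ?case
    by (simp add: partial_coord smooth_algebra.const)
next
  case (add F G)
  then have "partial c (\<lambda>p. F p + G p) = (\<lambda>p. partial c F p + partial c G p)"
    by (intro ext partial_add_mult smooth_algebra_differentiable)
  then show ?case
    using add by (simp add: smooth_algebra.add)
next
  case (mult F G)
  then have "partial c (\<lambda>p. F p * G p) = (\<lambda>p. F p * partial c G p + partial c F p * G p)"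
    by (intro ext partial_add_mult smooth_algebra_differentiable)
  then show ?case
    using mult by (simp add: smooth_algebra.add smooth_algebra.mult)
qed

lemma smooth_algebra_smooth: "smooth_algebra F \<Longrightarrow> smooth F"
  by (erule smooth_coinduct[of smooth_algebra])
    (auto intro: smooth_algebra_continuous smooth_algebra_differentiable smooth_algebra_partial)

section \<open>Differential functions and total derivatives\<close>

lemma depends_only_on_mono: "depends_only_on S F \<Longrightarrow> S \<subseteq> T \<Longrightarrow> depends_only_on T F"
  unfolding depends_only_on_def by blast

text \<open>The arbitrary \<open>\<phi>\<close> covers sums and products on jets as well as
  combinations on the lattice whose coefficients vary with the lattice point.\<close>

lemma depends_only_on_combine:
  assumes "depends_only_on S F" "depends_only_on S G"
  shows "depends_only_on S (\<lambda>p. \<phi> (F p) (G p))"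
  unfolding depends_only_on_def
proof (intro allI impI)
  fix p q :: "'a \<Rightarrow> real"
  assume "\<forall>c\<in>S. p c = q c"
  then have "F p = F q" "G p = G q"
    using assms unfolding depends_only_on_def by blast+
  then show "\<phi> (F p) (G p) = \<phi> (F q) (G q)"
    by simp
qed

lemma partial_eq_0_outside:
  assumes "depends_only_on S F" "c \<notin> S"
  shows "partial c F p = 0"
proof -
  have "F (p(c := s)) = F p" for s
    using assms(2) by (intro assms(1)[unfolded depends_only_on_def, rule_format]) auto
  then show ?thesis
    by (simp add: partial_def)
qed

lemma depends_only_on_partial:
  assumes "depends_only_on S F"
  shows "depends_only_on S (partial c F)"
proof (cases "c \<in> S")
  \<comment> \<open>Jets that agree on \<open>S\<close> still agree there after \<open>c\<close> is
    set to \<open>s\<close>, and for \<open>c \<in> S\<close> both derivatives are taken at the same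
    point \<open>p c = q c\<close>. Outside \<open>S\<close> these points may differ, but there the
    derivative is identically 0.\<close>
  case True
  have "partial c F p = partial c F q" if "\<forall>c\<in>S. p c = q c" for p q
  proof -
    have "F (p(c := s)) = F (q(c := s))" for s
      using that by (intro assms[unfolded depends_only_on_def, rule_format]) simp
    then show ?thesis
      using that True by (simp add: partial_def)
  qed
  then show ?thesis
    unfolding depends_only_on_def by blast
next
  case False
  then show ?thesis
    using partial_eq_0_outside[OF assms] by (simp add: depends_only_on_def)
qed

lemma differential_function_const: "differential_function (\<lambda>p. a)"
  unfolding differential_function_def
  by (auto intro!: smooth_algebra_smooth smooth_algebra.const exI[of _ "{}"]
      simp: depends_only_on_def)

lemma differential_function_coord: "differential_function (\<lambda>p. p c)"
  unfolding differential_function_def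
  by (auto intro!: smooth_algebra_smooth smooth_algebra.coord exI[of _ "{c}"]
      simp: depends_only_on_def)

lemma differential_function_common_support:
  assumes "differential_function F" "differential_function G"
  obtains S where "finite S" "depends_only_on S F" "depends_only_on S G"
  using assms unfolding differential_function_def
  by (meson depends_only_on_mono finite_UnI sup_ge1 sup_ge2)

lemma differential_function_add:
  assumes "differential_function F" "differential_function G"
  shows "differential_function (\<lambda>p. F p + G p)"
proof -
  obtain S where S: "finite S" "depends_only_on S F" "depends_only_on S G"
    using differential_function_common_support[OF assms] .
  then have "depends_only_on S (\<lambda>p. F p + G p)"
    using depends_only_on_combine[of S F G "(+)"] by blast
  moreover have "smooth (\<lambda>p. F p + G p)"
    using assms unfolding differential_function_def
    by (blast intro: smooth_algebra_smooth smooth_algebra.add[OF smooth_algebra.base smooth_algebra.base])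
  ultimately show ?thesis
    using S(1) unfolding differential_function_def by blast
qed

lemma differential_function_mult:
  assumes "differential_function F" "differential_function G"
  shows "differential_function (\<lambda>p. F p * G p)"
proof -
  obtain S where S: "finite S" "depends_only_on S F" "depends_only_on S G"
    using differential_function_common_support[OF assms] .
  then have "depends_only_on S (\<lambda>p. F p * G p)"
    using depends_only_on_combine[of S F G "(*)"] by blast
  moreover have "smooth (\<lambda>p. F p * G p)"
    using assms unfolding differential_function_def
    by (blast intro: smooth_algebra_smooth smooth_algebra.mult[OF smooth_algebra.base smooth_algebra.base])
  ultimately show ?thesis
    using S(1) unfolding differential_function_def by blast
qed

lemma differential_function_power:
  "differential_function F \<Longrightarrow> differential_function (\<lambda>p. F p ^ n)"
  by (induction n) (simp_all add: differential_function_const differential_function_mult)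

lemma differential_function_sum:
  assumes "finite T" "\<And>i. i \<in> T \<Longrightarrow> differential_function (F i)"
  shows "differential_function (\<lambda>p. \<Sum>i\<in>T. F i p)"
  using assms
  by (induction T rule: finite_induct)
    (simp_all add: differential_function_const differential_function_add)

lemma differential_function_partial:
  "differential_function F \<Longrightarrow> differential_function (partial c F)"
  unfolding differential_function_def using smoothD(3) depends_only_on_partial by blast

lemma partial_add:
  assumes "differential_function F" "differential_function G"
  shows "partial c (\<lambda>p. F p + G p) p = partial c F p + partial c G p"
  using assms unfolding differential_function_def
  by (intro partial_add_mult smooth_algebra_differentiable smooth_algebra.base) auto

lemma partial_mult:
  assumes "differential_function F" "differential_function G"
  shows "partial c (\<lambda>p. F p * G p) p = F p * partial c G p + partial c F p * G p"
  using assms unfolding differential_function_def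
  by (intro partial_add_mult smooth_algebra_differentiable smooth_algebra.base) auto

text \<open>\<open>Dx\<close> and \<open>Dt\<close> differ only in the explicit variable
  \<open>c\<close> and in the raised index \<open>\<sigma>\<close>, so linearity and the Leibniz
  rule are proved once for both.\<close>

definition total_derivative ::
  "jet_coord \<Rightarrow> (nat \<times> nat \<Rightarrow> jet_coord) \<Rightarrow> (jet \<Rightarrow> real) \<Rightarrow> jet \<Rightarrow> real" where
  "total_derivative c \<sigma> F p =
     partial c F p + Sum_any (\<lambda>i. p (\<sigma> i) * partial (case_prod Coord_u i) F p)"

lemma Dx_eq_total_derivative:
  "Dx = total_derivative Coord_x (\<lambda>(a, b). Coord_u (Suc a) b)"
  by (simp add: fun_eq_iff Dx_def total_derivative_def case_prod_unfold)

lemma Dt_eq_total_derivative: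
  "Dt = total_derivative Coord_t (\<lambda>(a, b). Coord_u a (Suc b))"
  by (simp add: fun_eq_iff Dt_def total_derivative_def case_prod_unfold)

text \<open>Partial derivatives outside the support vanish, and injectivity of
  \<open>Coord_u\<close> keeps the index set finite. This set depends on \<open>S\<close> alone, so
  functions with a common support are compared term by term.\<close>

lemma total_derivative_eq_sum:
  assumes "finite S" "depends_only_on S F"
  shows "total_derivative c \<sigma> F p = partial c F p +
    (\<Sum>i\<in>case_prod Coord_u -` S. p (\<sigma> i) * partial (case_prod Coord_u i) F p)"
    and "finite (case_prod Coord_u -` S)"
proof -
  show fin: "finite (case_prod Coord_u -` S)"
    using assms(1) by (intro finite_vimageI) (auto simp: inj_def)
  have "{i. p (\<sigma> i) * partial (case_prod Coord_u i) F p \<noteq> 0} \<subseteq> case_prod Coord_u -` S"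
    using partial_eq_0_outside[OF assms(2)] by fastforce
  then show "total_derivative c \<sigma> F p = partial c F p +
    (\<Sum>i\<in>case_prod Coord_u -` S. p (\<sigma> i) * partial (case_prod Coord_u i) F p)"
    unfolding total_derivative_def by (simp only: Sum_any.expand_superset[OF fin])
qed

lemma differential_function_total_derivative:
  assumes "differential_function F"
  shows "differential_function (total_derivative c \<sigma> F)"
proof -
  obtain S where "finite S" "depends_only_on S F"
    using assms unfolding differential_function_def by blast
  note S = total_derivative_eq_sum[OF this]
  show ?thesis
    \<comment> \<open>The index set does not vary with \<open>p\<close>, so the whole function is a
      finite sum of products of coordinates and partial derivatives.\<close>
    unfolding S(1)[abs_def]
    by (intro differential_function_add differential_function_sum differential_function_mult
        differential_function_partial differential_function_coord assms S(2))
qed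

lemma total_derivative_add:
  assumes "differential_function F" "differential_function G"
  shows "total_derivative c \<sigma> (\<lambda>p. F p + G p) p
    = total_derivative c \<sigma> F p + total_derivative c \<sigma> G p"
proof -
  obtain S where S: "finite S" "depends_only_on S F" "depends_only_on S G"
    using differential_function_common_support[OF assms] .
  then have "depends_only_on S (\<lambda>p. F p + G p)"
    using depends_only_on_combine[of S F G "(+)"] by blast
  then show ?thesis
    using S by (simp add: total_derivative_eq_sum partial_add[OF assms] sum.distrib algebra_simps)
qed

lemma total_derivative_mult:
  assumes "differential_function F" "differential_function G"
  shows "total_derivative c \<sigma> (\<lambda>p. F p * G p) p
    = F p * total_derivative c \<sigma> G p + total_derivative c \<sigma> F p * G p"
proof -
  obtain S where S: "finite S" "depends_only_on S F" "depends_only_on S G"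
    using differential_function_common_support[OF assms] .
  then have "depends_only_on S (\<lambda>p. F p * G p)"
    using depends_only_on_combine[of S F G "(*)"] by blast
  then show ?thesis
    using S by (simp add: total_derivative_eq_sum partial_mult[OF assms] sum.distrib
        sum_distrib_left sum_distrib_right algebra_simps)
qed

lemma total_derivative_const: "total_derivative c \<sigma> (\<lambda>p. a) p = 0"
  by (simp add: total_derivative_def partial_const)

section \<open>Integration by parts against powers of x\<close>

lemma Dx_power_x: "Dx (\<lambda>p. p Coord_x ^ n) p = real n * p Coord_x ^ (n - 1)"
  by (simp add: Dx_def partial_power_coord case_prod_unfold)

lemma Dt_power_x: "Dt (\<lambda>p. p Coord_x ^ n) p = 0"
  by (simp add: Dt_def partial_power_coord case_prod_unfold)

lemma differential_function_power_x: "differential_function (\<lambda>p. p Coord_x ^ n)"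
  by (intro differential_function_power differential_function_coord)

lemma differential_function_Dx_funpow:
  "differential_function F \<Longrightarrow> differential_function ((Dx ^^ k) F)"
  by (induction k)
    (simp_all add: Dx_eq_total_derivative differential_function_total_derivative)

text \<open>\<open>k\<close> is generalised because the step passes to order
  \<open>l = k - 1\<close>; \<open>Suc j < k\<close> becomes \<open>j < l\<close>, and at exponent 0
  at least one \<open>Dx\<close> is left to supply the antiderivative.\<close>

lemma power_x_Dx_funpow_is_Dx:
  assumes "differential_function f" "j < k"
  shows "\<exists>F. differential_function F \<and> (\<forall>p. Dx F p = p Coord_x ^ j * (Dx ^^ k) f p)"
  using \<open>j < k\<close>
proof (induction j arbitrary: k)
  case 0
  then obtain l where "k = Suc l"
    using gr0_implies_Suc by blast
  then show ?case
    using differential_function_Dx_funpow[OF assms(1)] by (intro exI[of _ "(Dx ^^ l) f"]) simp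
next
  case (Suc j)
  then obtain l where l: "k = Suc l" "j < l"
    by (metis Suc_lessE Suc_less_eq)
  obtain F where F: "differential_function F" "\<And>p. Dx F p = p Coord_x ^ j * (Dx ^^ l) f p"
    using Suc.IH[OF l(2)] by blast
  define h where "h = (Dx ^^ l) f"
  have h: "differential_function h"
    unfolding h_def by (rule differential_function_Dx_funpow[OF assms(1)])
  \<comment> \<open>\<open>Dx ?A\<close> is the desired term plus
    \<open>real (Suc j) * p Coord_x ^ j * h p\<close>; \<open>?B\<close> cancels the surplus, as
    \<open>F\<close> comes from the induction hypothesis with
    \<open>Dx F p = p Coord_x ^ j * h p\<close>.\<close>
  let ?A = "\<lambda>p. p Coord_x ^ Suc j * h p" and ?B = "\<lambda>p. - real (Suc j) * F p"
  have A: "differential_function ?A"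
    by (intro differential_function_mult differential_function_power_x h)
  have B: "differential_function ?B"
    by (intro differential_function_mult differential_function_const F(1))
  have "Dx (\<lambda>p. ?A p + ?B p) p = p Coord_x ^ Suc j * (Dx ^^ k) f p" for p
  proof -
    have "Dx ?A p = p Coord_x ^ Suc j * Dx h p + real (Suc j) * p Coord_x ^ j * h p"
      using Dx_power_x[of "Suc j" p] unfolding Dx_eq_total_derivative
      by (simp only: total_derivative_mult[OF differential_function_power_x h] diff_Suc_1)
    moreover have "Dx ?B p = - real (Suc j) * Dx F p"
      unfolding Dx_eq_total_derivative
      by (simp only: total_derivative_mult[OF differential_function_const F(1)]
          total_derivative_const mult_zero_left add_0_right)
    moreover have "Dx (\<lambda>p. ?A p + ?B p) p = Dx ?A p + Dx ?B p"
      unfolding Dx_eq_total_derivative by (rule total_derivative_add[OF A B])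
    ultimately have "Dx (\<lambda>p. ?A p + ?B p) p = p Coord_x ^ Suc j * Dx h p"
      unfolding F(2) h_def[symmetric] by (simp only:)
    moreover have "(Dx ^^ k) f = Dx h"
      by (simp add: l(1) h_def)
    ultimately show ?thesis
      by (simp only:)
  qed
  then show ?case
    using differential_function_add[OF A B] by blast
qed

section \<open>Difference functions\<close>

lemma difference_function_const: "difference_function (\<lambda>m n u. a m n)"
  unfolding difference_function_def depends_only_on_def by blast

lemma difference_function_combine:
  assumes "difference_function F" "difference_function G"
  shows "difference_function (\<lambda>m n u. \<phi> m n (F m n u) (G m n u))"
proof -
  obtain S T where "finite S" "\<forall>m n. depends_only_on S (F m n)"
    and "finite T" "\<forall>m n. depends_only_on T (G m n)"
    using assms unfolding difference_function_def by blast
  then have "finite (S \<union> T)"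
    and "\<forall>m n. depends_only_on (S \<union> T) (F m n)"
    and "\<forall>m n. depends_only_on (S \<union> T) (G m n)"
    using depends_only_on_mono by (blast, blast, blast)
  then have "finite (S \<union> T)"
    and "\<forall>m n. depends_only_on (S \<union> T) (\<lambda>u. \<phi> m n (F m n u) (G m n u))"
    using depends_only_on_combine[of "S \<union> T" "F m n" "G m n" "\<phi> m n" for m n] by blast+
  then show ?thesis
    unfolding difference_function_def by blast
qed

lemma difference_function_sum:
  assumes "finite I" "\<And>i. i \<in> I \<Longrightarrow> difference_function (F i)"
  shows "difference_function (\<lambda>m n u. \<Sum>i\<in>I. a i * F i m n u)"
  using assms
proof (induction I rule: finite_induct)
  case empty
  then show ?case
    by (simp add: difference_function_const)
next
  case (insert i I)
  then show ?case
    using difference_function_combine[where \<phi> = "\<lambda>m n y z. a i * y + z"] by simp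
qed

lemma difference_function_Sm:
  assumes "difference_function F"
  shows "difference_function (Sm F)"
proof -
  obtain S where S: "finite S" "\<And>m n. depends_only_on S (F m n)"
    using assms unfolding difference_function_def by blast
  \<comment> \<open>The shifted function reads \<open>u (i + 1, j)\<close> wherever \<open>F\<close>
    reads \<open>u (i, j)\<close>, so the stencil moves one place in the first direction.\<close>
  have "depends_only_on ((\<lambda>(i, j). (i + 1, j)) ` S) (Sm F m n)" for m n
    unfolding depends_only_on_def Sm_def
    by (intro allI impI S(2)[unfolded depends_only_on_def, rule_format]) force
  then show ?thesis
    using S(1) unfolding difference_function_def by blast
qed

lemma difference_function_Dm: "difference_function F \<Longrightarrow> difference_function (Dm h F)"
  using difference_function_combine[OF difference_function_Sm[of F], of F "\<lambda>m n y z. (y - z) / h"]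
  unfolding Dm_def[abs_def] by blast

lemma difference_function_Dm_funpow:
  "difference_function F \<Longrightarrow> difference_function ((Dm h ^^ k) F)"
  by (induction k) (simp_all add: difference_function_Dm)

section \<open>Summation by parts against powers of the grid points\<close>

lemma Dm_sum:
  "Dm h (\<lambda>m n u. \<Sum>i\<in>I. a i * F i m n u) m n u = (\<Sum>i\<in>I. a i * Dm h (F i) m n u)"
  by (simp add: Dm_def Sm_def sum_divide_distrib sum_subtractf diff_divide_distrib
      right_diff_distrib)

text \<open>In the binomial expansion of \<open>(y - h) ^ j\<close> the top term
  \<open>y ^ j\<close> cancels, leaving only powers below \<open>j\<close>.\<close>

lemma backward_difference_power:
  fixes y h :: real
  shows "y ^ j - (y - h) ^ j = (\<Sum>l<j. - (real (j choose l) * (- h) ^ (j - l)) * y ^ l)"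
proof -
  have "(y - h) ^ j = (\<Sum>l\<le>j. real (j choose l) * y ^ l * (- h) ^ (j - l))"
    using binomial_ring[of y "- h" j] by simp
  also have "\<dots> = (\<Sum>l<j. real (j choose l) * y ^ l * (- h) ^ (j - l)) + y ^ j"
    by (simp add: lessThan_Suc_atMost[symmetric])
  finally show ?thesis
    by (simp add: sum_negf[symmetric] mult_ac)
qed

text \<open>Strong induction replaces the simple one of the continuous case, because the backward
  difference of a power may involve all lower powers. They are all needed at the same order
  \<open>l\<close>, and \<open>i < j < Suc l\<close> gives \<open>i < l\<close>.\<close>

lemma power_x_Dm_funpow_is_Dm:
  assumes grid: "uniform_grid x h" and f: "difference_function f" and "j < k"
  shows "\<exists>F. difference_function F \<and>
    (\<forall>m n u. Dm h F m n u = x m ^ j * (Dm h ^^ k) f m n u)"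
  using \<open>j < k\<close>
proof (induction j arbitrary: k rule: less_induct)
  case (less j)
  then obtain l where k: "k = Suc l"
    using less_imp_Suc_add by blast
  have h: "h > 0" and x: "x (m + 1) = x m + h" for m
    using grid unfolding uniform_grid_def by (simp, metis mult_1 of_int_1)
  define H where "H = (Dm h ^^ l) f"
  have H: "difference_function H"
    unfolding H_def by (rule difference_function_Dm_funpow[OF f])
  have "\<forall>i\<in>{..<j}. \<exists>F. difference_function F \<and> (\<forall>m n u. Dm h F m n u = x m ^ i * H m n u)"
    using less.IH[of _ l] less.prems k unfolding H_def by auto
  then obtain F where F: "\<And>i. i < j \<Longrightarrow> difference_function (F i)"
    "\<And>i m n u. i < j \<Longrightarrow> Dm h (F i) m n u = x m ^ i * H m n u"
    by (metis lessThan_iff)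
  \<comment> \<open>These are the coefficients of the backward difference quotient of the
    \<open>j\<close>-th power, so \<open>Dm h R\<close> equals that quotient times
    \<open>H\<close>.\<close>
  define c where "c i = - (real (j choose i) * (- h) ^ (j - i)) / h" for i
  define R where "R = (\<lambda>m n u. \<Sum>i<j. c i * F i m n u)"
  have R: "difference_function R"
    unfolding R_def using F(1) by (intro difference_function_sum) auto
  have DR: "Dm h R m n u = (x m ^ j - (x m - h) ^ j) / h * H m n u" for m n u
  proof -
    have "Dm h R m n u = (\<Sum>i<j. c i * x m ^ i) * H m n u"
      by (simp add: R_def Dm_sum F(2) sum_distrib_right mult.assoc)
    also have "(\<Sum>i<j. c i * x m ^ i) = (x m ^ j - (x m - h) ^ j) / h"
      by (simp add: backward_difference_power c_def sum_divide_distrib)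
    finally show ?thesis .
  qed
  \<comment> \<open>The power is taken one grid point back so that the shift turns it into
    \<open>x m ^ j\<close>, the coefficient that \<open>Sm H\<close> must carry; the mismatch in the
    coefficient of the unshifted \<open>H\<close> is \<open>Dm h R\<close>.\<close>
  let ?G = "\<lambda>m n u. (x m - h) ^ j * H m n u - R m n u"
  have "Dm h ?G m n u = x m ^ j * (Dm h ^^ k) f m n u" for m n u
  proof -
    have "Dm h ?G m n u = (x m ^ j * Sm H m n u - (x m - h) ^ j * H m n u) / h - Dm h R m n u"
      by (simp add: Dm_def Sm_def x diff_divide_distrib)
    also have "\<dots> = x m ^ j * Dm h H m n u"
      unfolding DR using h by (simp add: Dm_def field_simps)
    finally show ?thesis
      by (simp add: H_def k)
  qed
  moreover have "difference_function ?G"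
    using difference_function_combine[OF H R, of "\<lambda>m n y z. (x m - h) ^ j * y - z"] .
  ultimately show ?case
    by blast
qed

section \<open>The two families of conservation laws\<close>

theorem theorem1:
  fixes k :: nat
  assumes "k \<ge> 1"
  shows
    "(\<forall>g f. autonomous_differential_function g \<longrightarrow> autonomous_differential_function f \<longrightarrow>
        (\<forall>i\<in>{1..k}. \<exists>F G.
           conservation_law (\<lambda>p. Dt g p + (Dx ^^ k) f p) (\<lambda>p. p Coord_x ^ (i - 1)) F G))
     \<and>
     (\<forall>x t \<Delta>x \<Delta>t. \<forall>g f :: (int \<times> int \<Rightarrow> real) \<Rightarrow> real.
        uniform_grid x \<Delta>x \<longrightarrow> uniform_grid t \<Delta>t \<longrightarrow>
        (\<exists>S. finite S \<and> depends_only_on S g) \<longrightarrow> (\<exists>S. finite S \<and> depends_only_on S f) \<longrightarrow>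
        (\<forall>i\<in>{1..k}. \<exists>F G.
           discrete_conservation_law \<Delta>x \<Delta>t
             (\<lambda>m n u. Dn \<Delta>t (\<lambda>m n. g) m n u + (Dm \<Delta>x ^^ k) (\<lambda>m n. f) m n u)
             (\<lambda>m n u. x m ^ (i - 1)) F G))"
proof (intro conjI allI impI ballI)
  fix g f :: "jet \<Rightarrow> real" and i
  assume "autonomous_differential_function g" "autonomous_differential_function f"
  then have g: "differential_function g" and f: "differential_function f"
    unfolding autonomous_differential_function_def differential_function_def by blast+
  assume "i \<in> {1..k}"
  \<comment> \<open>As \<open>i \<ge> 1\<close>, the subtraction is exact: the exponents run through
    0 to \<open>k - 1\<close>, the range in which integration by parts ends in an
    \<open>x\<close>-derivative.\<close>
  then have "i - 1 < k"
    by auto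
  then obtain F where F: "differential_function F"
    "\<And>p. Dx F p = p Coord_x ^ (i - 1) * (Dx ^^ k) f p"
    using power_x_Dx_funpow_is_Dx[OF f] by blast
  let ?G = "\<lambda>p. p Coord_x ^ (i - 1) * g p"
  have "Dt ?G p = p Coord_x ^ (i - 1) * Dt g p" for p
    using Dt_power_x[of "i - 1" p] unfolding Dt_eq_total_derivative
    by (simp only: total_derivative_mult[OF differential_function_power_x g]
        mult_zero_left add_0_right)
  moreover have "differential_function ?G"
    by (intro differential_function_mult differential_function_power_x g)
  ultimately have "conservation_law (\<lambda>p. Dt g p + (Dx ^^ k) f p) (\<lambda>p. p Coord_x ^ (i - 1)) F ?G"
    unfolding conservation_law_def using F by (simp add: algebra_simps)
  then show "\<exists>F G.
      conservation_law (\<lambda>p. Dt g p + (Dx ^^ k) f p) (\<lambda>p. p Coord_x ^ (i - 1)) F G"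
    by blast
next
  fix x t :: "int \<Rightarrow> real" and \<Delta>x \<Delta>t :: real and g f :: "(int \<times> int \<Rightarrow> real) \<Rightarrow> real" and i
  assume grid: "uniform_grid x \<Delta>x" and "uniform_grid t \<Delta>t"
    and "\<exists>S. finite S \<and> depends_only_on S g" "\<exists>S. finite S \<and> depends_only_on S f"
  then have g: "difference_function (\<lambda>m n. g)" and f: "difference_function (\<lambda>m n. f)"
    unfolding difference_function_def by blast+
  assume "i \<in> {1..k}"
  then have "i - 1 < k"
    by auto
  then obtain F where F: "difference_function F"
    "\<And>m n u. Dm \<Delta>x F m n u = x m ^ (i - 1) * (Dm \<Delta>x ^^ k) (\<lambda>m n. f) m n u"
    using power_x_Dm_funpow_is_Dm[OF grid f] by blast
  \<comment> \<open>\<open>Sn\<close> leaves \<open>m\<close> fixed, so the factor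
    \<open>x m ^ (i - 1)\<close> passes through \<open>Dn\<close> unchanged.\<close>
  let ?G = "\<lambda>m n u. x m ^ (i - 1) * g u"
  have "Dn \<Delta>t ?G m n u = x m ^ (i - 1) * Dn \<Delta>t (\<lambda>m n. g) m n u" for m n u
    by (simp add: Dn_def Sn_def right_diff_distrib)
  moreover have "difference_function ?G"
    using difference_function_combine[OF g g, of "\<lambda>m n y z. x m ^ (i - 1) * y"] .
  ultimately have "discrete_conservation_law \<Delta>x \<Delta>t
      (\<lambda>m n u. Dn \<Delta>t (\<lambda>m n. g) m n u + (Dm \<Delta>x ^^ k) (\<lambda>m n. f) m n u)
      (\<lambda>m n u. x m ^ (i - 1)) F ?G"
    unfolding discrete_conservation_law_def using F by (simp add: algebra_simps)
  then show "\<exists>F G. discrete_conservation_law \<Delta>x \<Delta>t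
      (\<lambda>m n u. Dn \<Delta>t (\<lambda>m n. g) m n u + (Dm \<Delta>x ^^ k) (\<lambda>m n. f) m n u)
      (\<lambda>m n u. x m ^ (i - 1)) F G"
    by blast
qed

end
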